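(* Let $\rho$ and $\nu$ be two spread probability measures on $W$ with $d_H(\rho,\nu)<\infty$, and let $U:W\to W$ be a measurable map such that $U\rho=\nu$. Let $T:W\to W$ be the optimal transport map sending $\rho$ to $\nu$ and $T^{-1}$ its ($\nu$-almost everywhere defined) inverse. Then $R=T^{-1}\circ U$ is a $\rho$-rotation (i.e. $R\rho=\rho$) and $U=T\circ R$ ($\rho$-almost surely). Moreover, if $U$ is a perturbation of identity, then $R$ is also a perturbation of identity. In both cases (whether or not $U$ is a perturbation of identity), $R$ is the $\rho$-almost everywhere unique minimal $\rho$-rotation, in the sense that $$\int_W|U(x)-R(x)|_H^2\,d\rho(x)=\inf_{R'\in\mathcal R}\int_W|U(x)-R'(x)|_H^2\,d\rho(x),$$ where $\mathcal R$ denotes the set of $\rho$-rotations, and any $R'\in\mathcal R$ attaining this infimum is equal to $R$ $\rho$-almost everywhere.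
   Context: Setting: $W$ is a separable Fréchet space equipped with a zero-mean Gaussian measure $\mu$ whose support is $W$; $H\hookrightarrow W$ is the corresponding Cameron–Martin (Hilbert) space with norm $|\cdot|_H$; we put $|z|_H=\infty$ for $z\in W\setminus H$. For a measurable map $T$ and a measure $\rho$, $T\rho$ denotes the image (push-forward) of $\rho$ under $T$. A finite-dimensional orthogonal projection $\pi$ of $H$ is called regular if it has a continuous extension to $W$, again denoted $\pi$; write $\pi^\perp=I_W-\pi$. Wasserstein distance: for probability measures $\rho,\nu$ on $W$, $\Sigma(\rho,\nu)$ is the set of probability measures on $W\times W$ with first marginal $\rho$ and second marginal $\nu$, and $d_H^2(\rho,\nu)=\inf_{\beta\in\Sigma(\rho,\nu)}\int_{W\times W}|x-y|_H^2\,d\beta(x,y)$. Spread measure: a probability measure $m$ on $W$ is called spread if there is an increasing sequence $(\pi_n,n\ge1)$ of regular orthogonal projections of $H$, $\pi_n$ of rank $n$, converging to $I_H$, such that for every $n\geq 1$ and for $\pi_n^\perp m$-almost all $x_n^\perp$ the regular conditional probability $m(\cdot\,|\,\pi_n^\perp=x_n^\perp)$, which is concentrated on the $n$-dimensional affine space $\pi_n(W)+x_n^\perp$, vanishes on the sets of Hausdorff dimension $n-1$. Optimal transport map (known theorem): if $\rho,\nu$ are spread and $d_H(\rho,\nu)<\infty$, there is a unique $\gamma\in\Sigma(\rho,\nu)$ attaining the infimum defining $d_H^2(\rho,\nu)$; it is of the form $\gamma=(I_W\times T)\rho$ (image of $\rho$ under $x\mapsto(x,T(x))$) for a Borel map $T=I_W+\xi$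 with $\xi\in H$ $\rho$-a.s., called the optimal transport map; and there is a map $T^{-1}=I_W+\eta$, with $\eta\in H$ $\nu$-a.s., such that $T^{-1}\circ T=I_W$ $\rho$-a.s., $T\circ T^{-1}=I_W$ $\nu$-a.s., and $\gamma=(T^{-1}\times I_W)\nu$. A measurable map $R:W\to W$ is a $\rho$-rotation if $R\rho=\rho$. A map $U:W\to W$ is a perturbation of identity if $U=I_W+u$ with $u$ taking values in $H$ ($\rho$-almost surely). *)

theory Defs
  imports "HOL-Probability.Probability"
begin

text \<open>
  A separable Frechet space is a locally convex topological vector space whose topology is second
  countable and induced by a complete translation-invariant metric. As usual for metric type
  classes, one such metric is part of the class structure; everything below uses only its topology.
\<close>

class separable_frechet_space = real_vector + topological_ab_group_add + polish_space +
  assumes dist_translation_invariant: "dist (x + z) (y + z) = dist x y"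
    and tendsto_scaleR_nhds:
      "filterlim (\<lambda>p. fst p *\<^sub>R snd p) (nhds (c *\<^sub>R x)) (nhds c \<times>\<^sub>F nhds x)"
    and locally_convex:
      "open S \<Longrightarrow> 0 \<in> S \<Longrightarrow> \<exists>C. open C \<and> 0 \<in> C \<and> C \<subseteq> S \<and>
        (\<forall>x\<in>C. \<forall>y\<in>C. \<forall>u\<ge>0. \<forall>v\<ge>0. u + v = 1 \<longrightarrow> u *\<^sub>R x + v *\<^sub>R y \<in> C)"

definition continuous_dual :: "('a::{real_vector,topological_space} \<Rightarrow> real) set" where
  "continuous_dual = {\<phi>. linear \<phi> \<and> continuous_on UNIV \<phi>}"

definition borel_prob :: "'a::topological_space measure \<Rightarrow> bool" where
  "borel_prob m \<longleftrightarrow> sets m = sets borel \<and> prob_space m"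

text \<open>The second disjunct below is the degenerate law \<open>N(0,0)\<close>.\<close>

definition centered_gaussian :: "'a::separable_frechet_space measure \<Rightarrow> bool" where
  "centered_gaussian \<mu> \<longleftrightarrow> borel_prob \<mu> \<and>
     (\<forall>\<phi>\<in>continuous_dual.
        (\<exists>\<sigma>>0. distributed \<mu> lborel \<phi> (normal_density 0 \<sigma>)) \<or> (AE x in \<mu>. \<phi> x = 0))"

definition topological_support :: "'a::topological_space measure \<Rightarrow> 'a set" where
  "topological_support m = {x. \<forall>S. open S \<and> x \<in> S \<longrightarrow> 0 < emeasure m S}"

text \<open>
  The Cameron--Martin norm
  \<open>|h|\<^sub>H = sup {\<phi>(h) | \<phi> \<in> W', \<integral> \<phi>\<^sup>2 d\<mu> \<le> 1}\<close>, defined on all of \<open>W\<close> with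
  value \<open>\<infinity>\<close> exactly off \<open>H\<close>. Taking absolute values does not change the supremum, since the set
  of admissible functionals is symmetric.
\<close>

definition cm_norm :: "'a::separable_frechet_space measure \<Rightarrow> 'a \<Rightarrow> ennreal" where
  "cm_norm \<mu> h =
     (SUP \<phi>\<in>{\<phi> \<in> continuous_dual. (\<integral>\<^sup>+x. ennreal ((\<phi> x)\<^sup>2) \<partial>\<mu>) \<le> 1}. ennreal \<bar>\<phi> h\<bar>)"

definition cm_space :: "'a::separable_frechet_space measure \<Rightarrow> 'a set" where
  "cm_space \<mu> = {h. cm_norm \<mu> h < \<infinity>}"

text \<open>The inner product of \<open>H\<close>, recovered from its norm by polarization (meaningful on \<open>H\<close> only).\<close>

definition cm_inner :: "'a::separable_frechet_space measure \<Rightarrow> 'a \<Rightarrow> 'a \<Rightarrow> real" where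
  "cm_inner \<mu> h k =
     ((enn2real (cm_norm \<mu> (h + k)))\<^sup>2 - (enn2real (cm_norm \<mu> (h - k)))\<^sup>2) / 4"

text \<open>Only the restriction of \<open>P\<close> to \<open>H\<close> matters: a linear, idempotent, self-adjoint operator on \<open>H\<close>
  with range of dimension \<open>n\<close>.\<close>

definition cm_orthogonal_projection ::
    "'a::separable_frechet_space measure \<Rightarrow> nat \<Rightarrow> ('a \<Rightarrow> 'a) \<Rightarrow> bool" where
  "cm_orthogonal_projection \<mu> n P \<longleftrightarrow>
     (\<forall>h\<in>cm_space \<mu>. P h \<in> cm_space \<mu>) \<and>
     (\<forall>h\<in>cm_space \<mu>. \<forall>k\<in>cm_space \<mu>. P (h + k) = P h + P k) \<and>
     (\<forall>h\<in>cm_space \<mu>. \<forall>c. P (c *\<^sub>R h) = c *\<^sub>R P h) \<and>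
     (\<forall>h\<in>cm_space \<mu>. P (P h) = P h) \<and>
     (\<forall>h\<in>cm_space \<mu>. \<forall>k\<in>cm_space \<mu>. cm_inner \<mu> (P h) k = cm_inner \<mu> h (P k)) \<and>
     (\<exists>B. finite B \<and> independent B \<and> card B = n \<and> span B = P ` cm_space \<mu>)"

text \<open>A regular projection is represented by its continuous extension to the whole space.\<close>

definition regular_projection ::
    "'a::separable_frechet_space measure \<Rightarrow> nat \<Rightarrow> ('a \<Rightarrow> 'a) \<Rightarrow> bool" where
  "regular_projection \<mu> n P \<longleftrightarrow> continuous_on UNIV P \<and> cm_orthogonal_projection \<mu> n P"

text \<open>The sequence is indexed by \<open>n \<ge> 1\<close>; the value \<open>P 0\<close> is irrelevant. Convergence to the identity
  of \<open>H\<close> is in the strong operator topology.\<close>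

definition regular_projection_sequence ::
    "'a::separable_frechet_space measure \<Rightarrow> (nat \<Rightarrow> 'a \<Rightarrow> 'a) \<Rightarrow> bool" where
  "regular_projection_sequence \<mu> P \<longleftrightarrow>
     (\<forall>n\<ge>1. regular_projection \<mu> n (P n)) \<and>
     (\<forall>n\<ge>1. P n ` cm_space \<mu> \<subseteq> P (Suc n) ` cm_space \<mu>) \<and>
     (\<forall>h\<in>cm_space \<mu>. (\<lambda>n. cm_norm \<mu> (P n h - h)) \<longlonglongrightarrow> 0)"

text \<open>
  Relative to an extended distance \<open>d\<close>. Only exponents \<open>s > 0\<close> are used, so the convention for
  \<open>0\<^sup>0\<close> plays no role; the empty set gets dimension \<open>0\<close>.
\<close>

definition ediam :: "('a \<Rightarrow> 'a \<Rightarrow> ennreal) \<Rightarrow> 'a set \<Rightarrow> ennreal" where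
  "ediam d A = (SUP x\<in>A. SUP y\<in>A. d x y)"

definition hausdorff_premeasure ::
    "('a \<Rightarrow> 'a \<Rightarrow> ennreal) \<Rightarrow> real \<Rightarrow> real \<Rightarrow> 'a set \<Rightarrow> ennreal" where
  "hausdorff_premeasure d s \<delta> A =
     (INF C\<in>{C :: nat \<Rightarrow> 'a set. A \<subseteq> (\<Union>i. C i) \<and> (\<forall>i. ediam d (C i) \<le> ennreal \<delta>)}.
        \<Sum>i. ennreal (enn2real (ediam d (C i)) powr s))"

definition hausdorff_measure ::
    "('a \<Rightarrow> 'a \<Rightarrow> ennreal) \<Rightarrow> real \<Rightarrow> 'a set \<Rightarrow> ennreal" where
  "hausdorff_measure d s A = (SUP \<delta>\<in>{0<..}. hausdorff_premeasure d s \<delta> A)"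

definition hausdorff_dimension :: "('a \<Rightarrow> 'a \<Rightarrow> ennreal) \<Rightarrow> 'a set \<Rightarrow> ennreal" where
  "hausdorff_dimension d A = (INF s\<in>{s. 0 < s \<and> hausdorff_measure d s A = 0}. ennreal s)"

text \<open>
  \<open>K\<close> is a version of the regular conditional probability \<open>m(\<cdot> | q = y)\<close>. On a Polish space it exists
  and is unique up to a null set of \<open>y\<close>, and for almost every \<open>y\<close> it is concentrated on the fibre
  \<open>{x. q x = y}\<close>.
\<close>

definition regular_conditional_prob ::
    "'a::topological_space measure \<Rightarrow> ('a \<Rightarrow> 'a) \<Rightarrow> ('a \<Rightarrow> 'a measure) \<Rightarrow> bool" where
  "regular_conditional_prob m q K \<longleftrightarrow>
     K \<in> borel \<rightarrow>\<^sub>M prob_algebra borel \<and>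
     (\<forall>A\<in>sets borel. \<forall>B\<in>sets borel.
        emeasure m (A \<inter> q -` B) = (\<integral>\<^sup>+y\<in>B. emeasure (K y) A \<partial>distr m borel q))"

text \<open>
  Hausdorff dimension inside the affine space \<open>y + P n (W)\<close> refers to its Euclidean structure, that
  is, to \<open>|x - y|\<^sub>H\<close>: a translation-invariant metric of \<open>W\<close> need not be bi-Lipschitz equivalent to it
  there and could give other dimensions. It is enough to test Borel sets, because every set is
  contained in a Borel set of the same dimension.
\<close>

definition spread :: "'a::separable_frechet_space measure \<Rightarrow> 'a measure \<Rightarrow> bool" where
  "spread \<mu> m \<longleftrightarrow> borel_prob m \<and>
     (\<exists>P. regular_projection_sequence \<mu> P \<and>
        (\<forall>n\<ge>1. \<exists>K. regular_conditional_prob m (\<lambda>x. x - P n x) K \<and>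
           (AE y in distr m borel (\<lambda>x. x - P n x).
              \<forall>A\<in>sets borel. A \<subseteq> {z + y | z. z \<in> range (P n)} \<and>
                hausdorff_dimension (\<lambda>x x'. cm_norm \<mu> (x - x')) A = of_nat (n - 1) \<longrightarrow>
                emeasure (K y) A = 0)))"

definition couplings ::
    "'a::separable_frechet_space measure \<Rightarrow> 'a measure \<Rightarrow> ('a \<times> 'a) measure set" where
  "couplings \<rho> \<nu> = {\<beta>. borel_prob \<beta> \<and> distr \<beta> borel fst = \<rho> \<and> distr \<beta> borel snd = \<nu>}"

definition transport_cost ::
    "'a::separable_frechet_space measure \<Rightarrow> ('a \<times> 'a) measure \<Rightarrow> ennreal" where
  "transport_cost \<mu> \<beta> = (\<integral>\<^sup>+p. (cm_norm \<mu> (fst p - snd p))\<^sup>2 \<partial>\<beta>)"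

text \<open>The squared distance \<open>d\<^sub>H\<^sup>2(\<rho>,\<nu>)\<close>.\<close>

definition wasserstein_sq ::
    "'a::separable_frechet_space measure \<Rightarrow> 'a measure \<Rightarrow> 'a measure \<Rightarrow> ennreal" where
  "wasserstein_sq \<mu> \<rho> \<nu> = (INF \<beta>\<in>couplings \<rho> \<nu>. transport_cost \<mu> \<beta>)"

definition optimal_couplings ::
    "'a::separable_frechet_space measure \<Rightarrow> 'a measure \<Rightarrow> 'a measure \<Rightarrow> ('a \<times> 'a) measure set" where
  "optimal_couplings \<mu> \<rho> \<nu> = {\<gamma> \<in> couplings \<rho> \<nu>. transport_cost \<mu> \<gamma> = wasserstein_sq \<mu> \<rho> \<nu>}"

text \<open>
  \<open>T\<close> is the optimal transport map if the unique optimal coupling is the image of \<open>\<rho>\<close> under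
  \<open>x \<mapsto> (x, T x)\<close>. If the distance is finite, \<open>T x - x \<in> H\<close> for \<open>\<rho>\<close>-almost all \<open>x\<close> follows.
\<close>

definition optimal_transport_map ::
    "'a::separable_frechet_space measure \<Rightarrow> 'a measure \<Rightarrow> 'a measure \<Rightarrow> ('a \<Rightarrow> 'a) \<Rightarrow> bool" where
  "optimal_transport_map \<mu> \<rho> \<nu> T \<longleftrightarrow>
     T \<in> borel_measurable borel \<and>
     optimal_couplings \<mu> \<rho> \<nu> = {distr \<rho> borel (\<lambda>x. (x, T x))}"

text \<open>An almost everywhere defined inverse, extended to the whole space as a Borel map.\<close>

definition ae_inverse ::
    "'a::topological_space measure \<Rightarrow> 'a measure \<Rightarrow> ('a \<Rightarrow> 'a) \<Rightarrow> ('a \<Rightarrow> 'a) \<Rightarrow> bool" where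
  "ae_inverse \<rho> \<nu> T S \<longleftrightarrow>
     S \<in> borel_measurable borel \<and> (AE x in \<rho>. S (T x) = x) \<and> (AE y in \<nu>. T (S y) = y)"

definition rotations :: "'a::topological_space measure \<Rightarrow> ('a \<Rightarrow> 'a) set" where
  "rotations \<rho> = {R \<in> borel_measurable borel. distr \<rho> borel R = \<rho>}"

definition perturbation_of_identity ::
    "'a::separable_frechet_space measure \<Rightarrow> 'a measure \<Rightarrow> ('a \<Rightarrow> 'a) \<Rightarrow> bool" where
  "perturbation_of_identity \<mu> \<rho> U \<longleftrightarrow> (AE x in \<rho>. U x - x \<in> cm_space \<mu>)"

end

theory Submission
  imports Defs
begin

text \<open>
  Sending a \<open>\<rho>\<close>-rotation \<open>R'\<close> to the law of \<open>(R', U)\<close> under \<open>\<rho>\<close> gives a coupling of \<open>\<rho>\<close> and \<open>\<nu>\<close>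
  whose cost is \<open>\<integral> |U - R'|\<^sub>H\<^sup>2 d\<rho>\<close>, so this integral is at least \<open>d\<^sub>H\<^sup>2(\<rho>,\<nu>)\<close>. For \<open>R = T\<inverse> \<circ> U\<close> the
  coupling is the optimal one, the law of \<open>(x, T x)\<close>. Conversely, if \<open>R'\<close> attains the infimum, then
  its coupling is concentrated on the graph of \<open>T\<close> by uniqueness of the optimal coupling, that is,
  \<open>U = T \<circ> R'\<close>, and applying \<open>T\<inverse>\<close> gives \<open>R' = R\<close>.
\<close>

lemma cm_norm_minus:
  fixes \<mu> :: "'w::separable_frechet_space measure"
  shows "cm_norm \<mu> (- h) = cm_norm \<mu> h"
  unfolding cm_norm_def by (intro SUP_cong) (auto simp: continuous_dual_def linear_neg)

lemma cm_norm_minus_commute: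
  fixes \<mu> :: "'w::separable_frechet_space measure"
  shows "cm_norm \<mu> (h - k) = cm_norm \<mu> (k - h)"
  using cm_norm_minus[of \<mu> "h - k"] by simp

lemma cm_norm_triangle:
  fixes \<mu> :: "'w::separable_frechet_space measure"
  shows "cm_norm \<mu> (h + k) \<le> cm_norm \<mu> h + cm_norm \<mu> k"
proof -
  let ?A = "{\<phi> \<in> continuous_dual. (\<integral>\<^sup>+x. ennreal ((\<phi> x)\<^sup>2) \<partial>\<mu>) \<le> 1}"
  have "ennreal \<bar>\<phi> (h + k)\<bar> \<le> cm_norm \<mu> h + cm_norm \<mu> k" if "\<phi> \<in> ?A" for \<phi>
  proof -
    have "linear \<phi>" using that by (auto simp: continuous_dual_def)
    then have "ennreal \<bar>\<phi> (h + k)\<bar> \<le> ennreal (\<bar>\<phi> h\<bar> + \<bar>\<phi> k\<bar>)"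
      by (intro ennreal_leI) (simp add: linear_add abs_triangle_ineq)
    also have "\<dots> = ennreal \<bar>\<phi> h\<bar> + ennreal \<bar>\<phi> k\<bar>" by simp
    also have "\<dots> \<le> cm_norm \<mu> h + cm_norm \<mu> k"
      unfolding cm_norm_def using that by (intro add_mono SUP_upper) auto
    finally show ?thesis .
  qed
  then show ?thesis
    unfolding cm_norm_def[of \<mu> "h + k"] by (rule SUP_least)
qed

lemma cm_space_add: "h \<in> cm_space \<mu> \<Longrightarrow> k \<in> cm_space \<mu> \<Longrightarrow> h + k \<in> cm_space \<mu>"
  using cm_norm_triangle[of \<mu> h k] by (auto simp: cm_space_def intro: le_less_trans)

text \<open>A supremum of continuous functions is lower semicontinuous. This gives Borel
  measurability of the norm on all of \<open>W\<close>, including where it is infinite.\<close>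

lemma open_cm_norm_greater:
  fixes \<mu> :: "'w::separable_frechet_space measure"
  shows "open {h. a < cm_norm \<mu> h}"
proof -
  let ?A = "{\<phi> \<in> continuous_dual. (\<integral>\<^sup>+x. ennreal ((\<phi> x)\<^sup>2) \<partial>\<mu>) \<le> 1}"
  have "{h. a < cm_norm \<mu> h} = (\<Union>\<phi>\<in>?A. {h. a < ennreal \<bar>\<phi> h\<bar>})"
    by (auto simp: cm_norm_def less_SUP_iff)
  moreover have "open {h. a < ennreal \<bar>\<phi> h\<bar>}" if "\<phi> \<in> ?A" for \<phi>
    using that by (intro open_Collect_less continuous_on_ennreal continuous_intros)
      (auto simp: continuous_dual_def)
  ultimately show ?thesis by auto
qed

lemma borel_measurable_cm_norm [measurable]:
  fixes \<mu> :: "'w::separable_frechet_space measure"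
  shows "cm_norm \<mu> \<in> borel_measurable borel"
  by (rule borel_measurableI_greater) (simp add: open_cm_norm_greater)

text \<open>Subtraction is continuous, and second countability makes the pair \<open>(f, g)\<close>
  Borel measurable.\<close>

lemma borel_measurable_minus_frechet [measurable (raw)]:
  fixes f g :: "'b \<Rightarrow> 'w::separable_frechet_space"
  assumes "f \<in> borel_measurable M" "g \<in> borel_measurable M"
  shows "(\<lambda>x. f x - g x) \<in> borel_measurable M"
  using assms by (rule borel_measurable_continuous_Pair) (intro continuous_intros)

text \<open>Couplings are measures on the Borel sets of the product topology, so the coordinates are
  needed as Borel maps there.\<close>

lemma borel_measurable_fst_snd [measurable]:
  "fst \<in> borel_measurable (borel :: ('a::topological_space \<times> 'b::topological_space) measure)"
  "snd \<in> borel_measurable (borel :: ('a::topological_space \<times> 'b::topological_space) measure)"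
  by (auto intro!: borel_measurable_continuous_onI continuous_intros)

lemma transport_cost_distr:
  fixes \<mu> :: "'w::separable_frechet_space measure"
  assumes [measurable]: "f \<in> borel_measurable M" "g \<in> borel_measurable M"
  shows "transport_cost \<mu> (distr M borel (\<lambda>x. (f x, g x))) = (\<integral>\<^sup>+x. (cm_norm \<mu> (g x - f x))\<^sup>2 \<partial>M)"
  unfolding transport_cost_def by (subst nn_integral_distr) (auto simp: cm_norm_minus_commute)

lemma distr_Pair_in_couplings:
  fixes f g :: "'w \<Rightarrow> 'w::separable_frechet_space"
  assumes "prob_space M" and [measurable]: "f \<in> borel_measurable M" "g \<in> borel_measurable M"
  shows "distr M borel (\<lambda>x. (f x, g x)) \<in> couplings (distr M borel f) (distr M borel g)"
  by (auto simp: couplings_def borel_prob_def distr_distr comp_def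
      intro!: prob_space.prob_space_distr assms)

lemma AE_distr_eqD:
  assumes "distr M N f = M'" and "AE y in M'. P y" and "f \<in> measurable M N"
  shows "AE x in M. P (f x)"
  using assms by (blast intro: AE_distrD)

theorem theorem4p1:
  fixes \<mu> \<rho> \<nu> :: "'w::separable_frechet_space measure"
    and U T T_inv R :: "'w \<Rightarrow> 'w"
  assumes "centered_gaussian \<mu>" and "topological_support \<mu> = UNIV"
    and "spread \<mu> \<rho>" and "spread \<mu> \<nu>"
    and "wasserstein_sq \<mu> \<rho> \<nu> < \<infinity>"
    and "U \<in> borel_measurable borel" and "distr \<rho> borel U = \<nu>"
    and "optimal_transport_map \<mu> \<rho> \<nu> T"
    and "ae_inverse \<rho> \<nu> T T_inv"
    and "R = T_inv \<circ> U"
  shows "R \<in> rotations \<rho> \<and>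
    (AE x in \<rho>. U x = T (R x)) \<and>
    (perturbation_of_identity \<mu> \<rho> U \<longrightarrow> perturbation_of_identity \<mu> \<rho> R) \<and>
    (\<integral>\<^sup>+x. (cm_norm \<mu> (U x - R x))\<^sup>2 \<partial>\<rho>) =
      (INF R'\<in>rotations \<rho>. \<integral>\<^sup>+x. (cm_norm \<mu> (U x - R' x))\<^sup>2 \<partial>\<rho>) \<and>
    (\<forall>R'\<in>rotations \<rho>.
      (\<integral>\<^sup>+x. (cm_norm \<mu> (U x - R' x))\<^sup>2 \<partial>\<rho>) =
        (INF R''\<in>rotations \<rho>. \<integral>\<^sup>+x. (cm_norm \<mu> (U x - R'' x))\<^sup>2 \<partial>\<rho>) \<longrightarrow>
      (AE x in \<rho>. R' x = R x))"
proof -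
  let ?J = "\<lambda>R'. \<integral>\<^sup>+x. (cm_norm \<mu> (U x - R' x))\<^sup>2 \<partial>\<rho>"
  let ?\<gamma> = "distr \<rho> borel (\<lambda>x. (x, T x))"
  have \<rho>: "sets \<rho> = sets borel" "prob_space \<rho>"
    using assms(3) by (auto simp: spread_def borel_prob_def)
  note [measurable_cong] = \<rho>(1)
  have [measurable]: "U \<in> borel_measurable borel" "T \<in> borel_measurable borel"
      "T_inv \<in> borel_measurable borel"
    using assms by (auto simp: optimal_transport_map_def ae_inverse_def)
  have R_meas [measurable]: "R \<in> borel_measurable borel"
    unfolding assms(10) by measurable
  have \<gamma>: "optimal_couplings \<mu> \<rho> \<nu> = {?\<gamma>}"
    using assms(8) by (simp add: optimal_transport_map_def)
  then have \<gamma>_opt: "?\<gamma> \<in> couplings \<rho> \<nu>" "transport_cost \<mu> ?\<gamma> = wasserstein_sq \<mu> \<rho> \<nu>"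
    by (auto simp: optimal_couplings_def)
  have T\<rho>: "distr \<rho> borel T = \<nu>"
    using \<gamma>_opt(1) by (simp add: couplings_def distr_distr comp_def)
  have inv_T: "AE x in \<rho>. T_inv (T x) = x" and T_inv: "AE y in \<nu>. T (T_inv y) = y"
    using assms(9) by (auto simp: ae_inverse_def)
  have distr_id: "distr \<rho> borel (\<lambda>x. x) = \<rho>"
    by (rule distr_id2[OF \<rho>(1)[symmetric]])

  \<comment> \<open>Both \<open>U\<close> and \<open>T\<close> push \<rho> to \<nu>, so
    \<open>U\<close> may be replaced by \<open>T\<close>, which \<open>T_inv\<close> undoes almost
    everywhere.\<close>
  have "distr \<rho> borel R = distr (distr \<rho> borel U) borel T_inv"
    by (simp add: distr_distr assms(10))
  also have "\<dots> = distr (distr \<rho> borel T) borel T_inv"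
    by (simp add: assms(7) T\<rho>)
  also have "\<dots> = distr \<rho> borel (\<lambda>x. T_inv (T x))"
    by (simp add: distr_distr comp_def)
  also have "\<dots> = distr \<rho> borel (\<lambda>x. x)"
    using inv_T by (intro distr_cong_AE) auto
  finally have R\<rho>: "distr \<rho> borel R = \<rho>"
    by (simp add: distr_id)
  then have R_rot: "R \<in> rotations \<rho>"
    by (simp add: rotations_def R_meas)

  \<comment> \<open>The identity for \<open>T (T_inv y)\<close> holds off a \<nu>-null set, whose
    preimage under \<open>U\<close> is \<rho>-null.\<close>
  have UTR: "AE x in \<rho>. U x = T (R x)"
    using AE_distr_eqD[OF assms(7) T_inv] by (simp add: assms(10) eq_commute)

  have pert: "perturbation_of_identity \<mu> \<rho> R" if U: "perturbation_of_identity \<mu> \<rho> U"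
  proof -
    \<comment> \<open>Finite optimal cost forces the displacement of \<open>T\<close> into
      \<open>H\<close> almost everywhere.\<close>
    have "(\<integral>\<^sup>+x. (cm_norm \<mu> (T x - x))\<^sup>2 \<partial>\<rho>) < \<infinity>"
      using \<gamma>_opt(2) assms(5) by (simp add: transport_cost_distr)
    then have "AE x in \<rho>. (cm_norm \<mu> (T x - x))\<^sup>2 \<noteq> \<infinity>"
      by (intro nn_integral_PInf_AE) auto
    then have "AE x in \<rho>. x - T x \<in> cm_space \<mu>"
      by (auto simp: cm_space_def cm_norm_minus_commute[of \<mu> _ "T _"] less_top[symmetric]
          power_eq_top_ennreal elim!: eventually_mono)
    \<comment> \<open>Invariance of \<rho> under \<open>R\<close> moves this from \<open>x\<close>
      to \<open>R x\<close>. As \<open>T (R x) = U x\<close>, adding \<open>U x - x\<close> yields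
      \<open>R x - x\<close>.\<close>
    then have "AE x in \<rho>. R x - T (R x) \<in> cm_space \<mu>"
      by (rule AE_distr_eqD[OF R\<rho>]) measurable
    with UTR U show ?thesis
      unfolding perturbation_of_identity_def
    proof eventually_elim
      case (elim x)
      then show ?case
        using cm_space_add[of "R x - T (R x)" \<mu> "U x - x"] by simp
    qed
  qed

  have coupling: "distr \<rho> borel (\<lambda>x. (R' x, U x)) \<in> couplings \<rho> \<nu>"
      and cost: "transport_cost \<mu> (distr \<rho> borel (\<lambda>x. (R' x, U x))) = ?J R'"
    if "R' \<in> rotations \<rho>" for R'
  proof -
    from that have [measurable]: "R' \<in> borel_measurable borel" and R': "distr \<rho> borel R' = \<rho>"
      by (auto simp: rotations_def)
    show "distr \<rho> borel (\<lambda>x. (R' x, U x)) \<in> couplings \<rho> \<nu>"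
      using distr_Pair_in_couplings[OF \<rho>(2), of R' U] by (simp add: R' assms(7))
    show "transport_cost \<mu> (distr \<rho> borel (\<lambda>x. (R' x, U x))) = ?J R'"
      by (rule transport_cost_distr) measurable
  qed

  \<comment> \<open>Since \<open>U = T \<circ> R\<close> almost everywhere and \<open>R\<close>
    preserves \<rho>, the coupling induced by \<open>R\<close> is \<open>?\<gamma>\<close>.\<close>
  have "distr \<rho> borel (\<lambda>x. (R x, U x)) = distr \<rho> borel (\<lambda>x. (R x, T (R x)))"
    using UTR by (intro distr_cong_AE) auto
  also have "\<dots> = distr (distr \<rho> borel R) borel (\<lambda>x. (x, T x))"
    by (simp add: distr_distr comp_def)
  finally have "?J R = wasserstein_sq \<mu> \<rho> \<nu>"
    using cost[OF R_rot] \<gamma>_opt(2) by (simp add: R\<rho>)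
  moreover have lower: "wasserstein_sq \<mu> \<rho> \<nu> \<le> ?J R'" if "R' \<in> rotations \<rho>" for R'
    unfolding wasserstein_sq_def cost[OF that, symmetric] by (rule INF_lower[OF coupling[OF that]])
  \<comment> \<open>The infimum is now identified with the squared distance, so a rotation attaining
    it induces an optimal coupling.\<close>
  ultimately have inf: "(INF R'\<in>rotations \<rho>. ?J R') = wasserstein_sq \<mu> \<rho> \<nu>"
      "?J R = (INF R'\<in>rotations \<rho>. ?J R')"
    using R_rot by (auto intro!: antisym INF_lower2[OF R_rot] INF_greatest)

  have uniq: "AE x in \<rho>. R' x = R x" if R': "R' \<in> rotations \<rho>" and "?J R' = wasserstein_sq \<mu> \<rho> \<nu>" for R'
  proof -
    from R' have [measurable]: "R' \<in> borel_measurable borel" and R'\<rho>: "distr \<rho> borel R' = \<rho>"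
      by (auto simp: rotations_def)
    have "distr \<rho> borel (\<lambda>x. (R' x, U x)) \<in> optimal_couplings \<mu> \<rho> \<nu>"
      using that coupling cost by (simp add: optimal_couplings_def)
    then have eq: "distr \<rho> borel (\<lambda>x. (R' x, U x)) = ?\<gamma>"
      by (simp add: \<gamma>)
    \<comment> \<open>\<open>?\<gamma>\<close> is carried by the graph of \<open>T\<close>; pulled
      back along \<open>(R', U)\<close>, this says that \<open>T \<circ> R' = U\<close> almost
      everywhere.\<close>
    have "AE p in ?\<gamma>. T (fst p) = snd p"
      by (subst AE_distr_iff) auto
    then have "AE x in \<rho>. T (R' x) = U x"
      unfolding eq[symmetric] by (subst (asm) AE_distr_iff) auto
    \<comment> \<open>\<open>T_inv\<close> inverts \<open>T\<close> only off a \<rho>-null set; the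
      preimage of that set under \<open>R'\<close> is null because \<open>R'\<close> preserves
      \<rho>.\<close>
    moreover have "AE x in \<rho>. T_inv (T (R' x)) = R' x"
      using inv_T by (rule AE_distr_eqD[OF R'\<rho>]) measurable
    ultimately show ?thesis
      by eventually_elim (simp add: assms(10))
  qed
  show ?thesis
    using R_rot UTR pert inf(2) uniq unfolding inf(1) by blast
qed

end
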